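(* Let $\mathcal{V}\subseteq\mathbb{C}^n$ be a self-conjugate algebraic variety, let $\mathcal{R}=\mathbb{R}[\mathcal{V}]$, and let $p\in\mathcal{R}$ be nonnegative on $\mathcal{V}\cap\mathbb{R}^n$. Let $d\in\mathbb{N}$, let $(F,Z)$ be a sampling $d$-SOS pre-certificate for $p$ on $\mathcal{V}$, and let $\mathcal{L}_{2d}\subseteq\mathcal{R}$ be a linear subspace such that $p\in\mathcal{L}_{2d}$ and $F\in\mathcal{L}_{2d}$ (where $F$ is viewed as an element of $\mathcal{R}$). If $(\mathcal{L}_{2d},Z)$ is poised, then the pre-certificate $(F,Z)$ is correct.
   Context: An algebraic variety in $\mathbb{C}^n$ is the common zero set of a set of polynomials; it is self-conjugate if it equals the set $\overline{\mathcal{V}}$ of complex conjugates of its points. The (real) coordinate ring is $\mathbb{R}[\mathcal{V}]:=\mathbb{R}[x_1,\ldots,x_n]/\{f\in\mathbb{R}[x_1,\ldots,x_n]: f(z)=0\text{ for all }z\in\mathcal{V}\}$; its elements are identified with the (complex-valued) functions they define on $\mathcal{V}$. A polynomial $F\in\mathbb{R}[x_1,\ldots,x_n]$ is SOS if $F=\sum_i f_i^2$ (finite sum) with $f_i\in\mathbb{R}[x_1,\ldots,x_n]$. Sampling $d$-SOS pre-certificate (for $p$ on $\mathcal{V}$): a pair $(F,Z)$ where $F\in\mathbb{R}[x_1,\ldots,x_n]$ is SOS with $\deg(F)\leq 2d$, and $Z=\{z_1,\ldots,z_S\}\subseteq\mathcal{V}$ is a finite set of (complex) samples such that $p(z_s)=F(z_s)$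 for $s=1,\ldots,S$. The pre-certificate $(F,Z)$ is correct if $F$ is a $d$-SOS($\mathcal{V}$) certificate for $p$, i.e. $F$ is SOS, $\deg(F)\leq 2d$, and $p(z)=F(z)$ for all $z\in\mathcal{V}$. Poisedness: for a linear subspace $\mathcal{L}\subseteq\mathbb{R}[\mathcal{V}]$ and a set $Z\subseteq\mathcal{V}$, the pair $(\mathcal{L},Z)$ is poised if the only $q\in\mathcal{L}$ with $q(z)=0$ for all $z\in Z$ is $q=0$ in $\mathbb{R}[\mathcal{V}]$. The subscript in $\mathcal{L}_{2d}$ is only notation. *)

theory Defs
  imports
    "HOL-Analysis.Finite_Cartesian_Product"
    "HOL-Library.Poly_Mapping"
    "HOL-Library.Nonpos_Ints"
    "HOL-Algebra.QuotRing"
    "HOL-Algebra.Module"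
begin

text \<open>Polynomials in the variables indexed by \<open>'n\<close>: finitely supported maps from exponent
  vectors to coefficients, with the convolution product of \<open>Poly_Mapping\<close>.\<close>

type_synonym ('n, 'a) mpoly = "('n \<Rightarrow>\<^sub>0 nat) \<Rightarrow>\<^sub>0 'a"

definition eval :: "('n::finite, 'a::comm_semiring_1) mpoly \<Rightarrow> 'a ^ 'n \<Rightarrow> 'a" where
  "eval f z = (\<Sum>m\<in>Poly_Mapping.keys f.
     Poly_Mapping.lookup f m * (\<Prod>i\<in>UNIV. (z $ i) ^ Poly_Mapping.lookup m i))"

text \<open>A real polynomial as a function on complex points.\<close>

definition ceval :: "('n::finite, real) mpoly \<Rightarrow> complex ^ 'n \<Rightarrow> complex" where
  "ceval f z = eval (Poly_Mapping.map complex_of_real f) z"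

text \<open>With the convention that the zero polynomial has degree 0, which does not affect upper
  bounds on the degree.\<close>

definition total_degree :: "('n::finite, 'a::zero) mpoly \<Rightarrow> nat" where
  "total_degree f =
     Max (insert 0 ((\<lambda>m. \<Sum>i\<in>UNIV. Poly_Mapping.lookup m i) ` Poly_Mapping.keys f))"

definition is_SOS :: "('n::finite, real) mpoly \<Rightarrow> bool" where
  "is_SOS F \<longleftrightarrow> (\<exists>fs. F = (\<Sum>f\<leftarrow>fs. f ^ 2))"

definition algebraic_variety :: "(complex ^ 'n::finite) set \<Rightarrow> bool" where
  "algebraic_variety V \<longleftrightarrow>
     (\<exists>P :: ('n, complex) mpoly set. V = {z. \<forall>f\<in>P. eval f z = 0})"

definition self_conjugate :: "(complex ^ 'n::finite) set \<Rightarrow> bool" where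
  "self_conjugate V \<longleftrightarrow> V = (\<lambda>z. \<chi> i. cnj (z $ i)) ` V"

text \<open>A commutative ring given by a type class, as a structure in the sense of HOL-Algebra.\<close>

definition type_ring :: "'a::comm_ring_1 ring" where
  "type_ring = \<lparr>carrier = UNIV, mult = (*), one = 1, zero = 0, add = (+)\<rparr>"

definition vanishing_ideal :: "(complex ^ 'n::finite) set \<Rightarrow> ('n, real) mpoly set" where
  "vanishing_ideal V = {f. \<forall>z\<in>V. ceval f z = 0}"

definition coord_class ::
  "(complex ^ 'n::finite) set \<Rightarrow> ('n, real) mpoly \<Rightarrow> ('n, real) mpoly set" where
  "coord_class V f = vanishing_ideal V +>\<^bsub>type_ring\<^esub> f"

text \<open>The coordinate ring is the quotient of the real polynomial ring by the vanishing ideal; a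
  scalar \<open>c\<close> acts as multiplication by the class of the constant polynomial \<open>c\<close>.\<close>

definition coord_ring ::
  "(complex ^ 'n::finite) set \<Rightarrow> (real, ('n, real) mpoly set) module" where
  "coord_ring V =
     (let Q = type_ring Quot vanishing_ideal V in
      \<lparr>carrier = carrier Q, mult = mult Q, one = one Q, zero = zero Q, add = add Q,
       smult = (\<lambda>c q. coord_class V (Poly_Mapping.single 0 c) \<otimes>\<^bsub>Q\<^esub> q)\<rparr>)"

text \<open>The function on \<open>V\<close> defined by a residue class: all representatives take the same value at
  a point of \<open>V\<close>, see \<open>coord_eval_class\<close> below. It is meaningful at points of \<open>V\<close> only.\<close>

definition coord_eval :: "('n::finite, real) mpoly set \<Rightarrow> complex ^ 'n \<Rightarrow> complex" where
  "coord_eval q z = the_elem ((\<lambda>f. ceval f z) ` q)"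

definition nonneg_on_real_points ::
  "(complex ^ 'n::finite) set \<Rightarrow> ('n, real) mpoly set \<Rightarrow> bool" where
  "nonneg_on_real_points V p \<longleftrightarrow>
     (\<forall>z\<in>V. (\<forall>i. z $ i \<in> \<real>) \<longrightarrow> coord_eval p z \<in> \<real>\<^sub>\<ge>\<^sub>0)"

definition SOS_certificate ::
  "(complex ^ 'n::finite) set \<Rightarrow> nat \<Rightarrow> ('n, real) mpoly set \<Rightarrow> ('n, real) mpoly \<Rightarrow> bool" where
  "SOS_certificate V d p F \<longleftrightarrow>
     is_SOS F \<and> total_degree F \<le> 2 * d \<and> (\<forall>z\<in>V. coord_eval p z = ceval F z)"

fun sampling_precertificate ::
  "(complex ^ 'n::finite) set \<Rightarrow> nat \<Rightarrow> ('n, real) mpoly set \<Rightarrow>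
     ('n, real) mpoly \<times> (complex ^ 'n) set \<Rightarrow> bool" where
  "sampling_precertificate V d p (F, Z) \<longleftrightarrow>
     is_SOS F \<and> total_degree F \<le> 2 * d \<and> finite Z \<and> Z \<subseteq> V \<and>
     (\<forall>z\<in>Z. coord_eval p z = ceval F z)"

fun correct_precertificate ::
  "(complex ^ 'n::finite) set \<Rightarrow> nat \<Rightarrow> ('n, real) mpoly set \<Rightarrow>
     ('n, real) mpoly \<times> (complex ^ 'n) set \<Rightarrow> bool" where
  "correct_precertificate V d p (F, Z) \<longleftrightarrow> SOS_certificate V d p F"

abbreviation linear_subspace ::
  "(complex ^ 'n::finite) set \<Rightarrow> ('n, real) mpoly set set \<Rightarrow> bool" where
  "linear_subspace V L \<equiv> submodule L (type_ring :: real ring) (coord_ring V)"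

definition poised ::
  "(complex ^ 'n::finite) set \<Rightarrow> ('n, real) mpoly set set \<Rightarrow> (complex ^ 'n) set \<Rightarrow> bool" where
  "poised V L Z \<longleftrightarrow>
     (\<forall>q\<in>L. (\<forall>z\<in>Z. coord_eval q z = 0) \<longrightarrow> q = \<zero>\<^bsub>coord_ring V\<^esub>)"


subsection \<open>Well-definedness of the coordinate ring\<close>

lemma type_ring_simps [simp]:
  "carrier (type_ring :: 'a::comm_ring_1 ring) = UNIV"
  "x \<otimes>\<^bsub>type_ring\<^esub> y = x * y" "x \<oplus>\<^bsub>type_ring\<^esub> y = x + y"
  "\<one>\<^bsub>type_ring\<^esub> = (1::'a)" "\<zero>\<^bsub>type_ring\<^esub> = (0::'a)"
  by (simp_all add: type_ring_def)

lemma cring_type_ring: "cring (type_ring :: 'a::comm_ring_1 ring)"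
proof (rule cringI)
  show "abelian_group (type_ring :: 'a ring)"
    by (rule abelian_groupI) (auto simp: algebra_simps intro: exI[of _ "- _"])
  show "comm_monoid (type_ring :: 'a ring)"
    by (rule comm_monoidI) (auto simp: algebra_simps)
qed (auto simp: algebra_simps)

lemma lookup_map_of_real [simp]:
  "Poly_Mapping.lookup (Poly_Mapping.map complex_of_real f) m
     = complex_of_real (Poly_Mapping.lookup f m)"
  by (simp add: Poly_Mapping.map.rep_eq when_def)

definition monom_eval :: "('n::finite \<Rightarrow>\<^sub>0 nat) \<Rightarrow> complex ^ 'n \<Rightarrow> complex" where
  "monom_eval m z = (\<Prod>i\<in>UNIV. (z $ i) ^ Poly_Mapping.lookup m i)"

lemma monom_eval_add: "monom_eval (m + k) z = monom_eval m z * monom_eval k z"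
  by (simp add: monom_eval_def lookup_add power_add prod.distrib)

lemma ceval_conv_sum:
  assumes "finite A" "Poly_Mapping.keys f \<subseteq> A"
  shows "ceval f z = (\<Sum>m\<in>A. complex_of_real (Poly_Mapping.lookup f m) * monom_eval m z)"
proof -
  have "Poly_Mapping.keys (Poly_Mapping.map complex_of_real f) = Poly_Mapping.keys f"
    by (auto simp: in_keys_iff)
  then show ?thesis
    unfolding ceval_def eval_def monom_eval_def
    using assms by (auto simp: in_keys_iff intro!: sum.mono_neutral_left)
qed

lemma ceval_zero [simp]: "ceval 0 z = 0"
  by (subst ceval_conv_sum[of "{}"]) auto

lemma ceval_add: "ceval (f + g) z = ceval f z + ceval g z"
proof -
  let ?A = "Poly_Mapping.keys f \<union> Poly_Mapping.keys g"
  have "Poly_Mapping.keys (f + g) \<subseteq> ?A" by (rule Poly_Mapping.keys_add)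
  then show ?thesis
    by (simp add: ceval_conv_sum[of ?A] lookup_add sum.distrib algebra_simps)
qed

lemma ceval_uminus: "ceval (- f) z = - ceval f z"
  using ceval_add[of f "- f" z] by (simp add: eq_neg_iff_add_eq_0 add.commute)

lemma ceval_diff: "ceval (f - g) z = ceval f z - ceval g z"
  using ceval_add[of f "- g" z] by (simp add: ceval_uminus)

lemma ceval_single: "ceval (Poly_Mapping.single m c) z = complex_of_real c * monom_eval m z"
  by (subst ceval_conv_sum[of "{m}"]) (auto simp: lookup_single split: if_splits)

lemma poly_mapping_single_induct:
  fixes f :: "'k \<Rightarrow>\<^sub>0 'b::comm_monoid_add"
  assumes "\<And>m c. P (Poly_Mapping.single m c)" "\<And>f g. P f \<Longrightarrow> P g \<Longrightarrow> P (f + g)"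
  shows "P f"
proof (induction f rule: update_induct)
  case const
  show ?case using assms(1)[of undefined 0] by simp
next
  case (update f a b)
  then have "Poly_Mapping.update a b f = Poly_Mapping.single a b + f"
    by (intro poly_mapping_eqI)
      (auto simp: lookup_update lookup_add lookup_single in_keys_iff when_def)
  then show ?case using update.IH assms by simp
qed

lemma ceval_mult: "ceval (f * g) z = ceval f z * ceval g z"
proof (induction f rule: poly_mapping_single_induct)
  case (1 m c)
  show ?case
    by (induction g rule: poly_mapping_single_induct)
       (simp_all add: Poly_Mapping.mult_single ceval_single monom_eval_add ceval_add
        distrib_left)
qed (simp add: distrib_right ceval_add)

lemma ideal_vanishing_ideal: "ideal (vanishing_ideal V) type_ring"
proof (rule idealI)
  interpret cring "type_ring :: ('a, real) mpoly ring" by (rule cring_type_ring)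
  show "ring (type_ring :: ('a, real) mpoly ring)" by (rule ring_axioms)
  have inv: "\<ominus>\<^bsub>type_ring\<^esub> f = - f" for f :: "('a, real) mpoly"
    by (rule minus_equality) auto
  show "subgroup (vanishing_ideal V) (add_monoid type_ring)"
    by (rule add.subgroupI)
      (auto simp: vanishing_ideal_def ceval_add ceval_uminus inv intro: exI[of _ 0])
qed (auto simp: vanishing_ideal_def ceval_mult)

lemma coord_class_eq: "coord_class V f = {g. \<forall>z\<in>V. ceval g z = ceval f z}"
proof -
  have "\<exists>h. (\<forall>z\<in>V. ceval h z = 0) \<and> g = h + f" if "\<forall>z\<in>V. ceval g z = ceval f z" for g
    using that by (intro exI[of _ "g - f"]) (simp add: ceval_diff)
  then show ?thesis
    by (auto simp: coord_class_def a_r_coset_def' vanishing_ideal_def ceval_add)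
qed

lemma coord_eval_class:
  assumes "z \<in> V"
  shows "coord_eval (coord_class V f) z = ceval f z"
proof -
  have "(\<lambda>g. ceval g z) ` coord_class V f = {ceval f z}"
    using assms by (auto simp: coord_class_eq)
  then show ?thesis by (simp add: coord_eval_def)
qed

lemma carrier_coord_ring: "carrier (coord_ring V) = range (coord_class V)"
  by (auto simp: coord_ring_def FactRing_def A_RCOSETS_def' coord_class_def)

lemma coord_ring_ops:
  "coord_class V f \<oplus>\<^bsub>coord_ring V\<^esub> coord_class V g = coord_class V (f + g)"
  "coord_class V f \<otimes>\<^bsub>coord_ring V\<^esub> coord_class V g = coord_class V (f * g)"
  "\<zero>\<^bsub>coord_ring V\<^esub> = coord_class V 0"
  "\<one>\<^bsub>coord_ring V\<^esub> = coord_class V 1"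
  "c \<odot>\<^bsub>coord_ring V\<^esub> coord_class V g = coord_class V (Poly_Mapping.single 0 c * g)"
proof -
  interpret ideal "vanishing_ideal V" type_ring by (rule ideal_vanishing_ideal)
  show "coord_class V f \<oplus>\<^bsub>coord_ring V\<^esub> coord_class V g = coord_class V (f + g)"
    "coord_class V f \<otimes>\<^bsub>coord_ring V\<^esub> coord_class V g = coord_class V (f * g)"
    "\<one>\<^bsub>coord_ring V\<^esub> = coord_class V 1"
    "c \<odot>\<^bsub>coord_ring V\<^esub> coord_class V g = coord_class V (Poly_Mapping.single 0 c * g)"
    by (simp_all add: coord_ring_def FactRing_def coord_class_def a_rcos_sum rcoset_mult_add)
  show "\<zero>\<^bsub>coord_ring V\<^esub> = coord_class V 0"
    by (simp add: coord_ring_def FactRing_def coord_class_eq vanishing_ideal_def)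
qed

lemma algebra_coord_ring: "algebra (type_ring :: real ring) (coord_ring V)"
proof (rule algebraI)
  show "cring (coord_ring V)"
  proof (rule cringI)
    show "abelian_group (coord_ring V)"
    proof (rule abelian_groupI)
      fix x assume "x \<in> carrier (coord_ring V)"
      then obtain f where "x = coord_class V f" by (auto simp: carrier_coord_ring)
      then show "\<exists>y\<in>carrier (coord_ring V). y \<oplus>\<^bsub>coord_ring V\<^esub> x = \<zero>\<^bsub>coord_ring V\<^esub>"
        by (intro bexI[of _ "coord_class V (- f)"])
          (auto simp: carrier_coord_ring coord_ring_ops)
    qed (auto simp: carrier_coord_ring coord_ring_ops algebra_simps)
    show "comm_monoid (coord_ring V)"
      by (rule comm_monoidI) (auto simp: carrier_coord_ring coord_ring_ops algebra_simps)
  qed (auto simp: carrier_coord_ring coord_ring_ops algebra_simps)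
next
  have const_mult: "Poly_Mapping.single (0 :: 'a \<Rightarrow>\<^sub>0 nat) (a * b)
      = Poly_Mapping.single 0 a * Poly_Mapping.single 0 b" for a b :: real
    by (simp add: Poly_Mapping.mult_single)
  show "(a \<otimes>\<^bsub>type_ring\<^esub> b) \<odot>\<^bsub>coord_ring V\<^esub> x
      = a \<odot>\<^bsub>coord_ring V\<^esub> (b \<odot>\<^bsub>coord_ring V\<^esub> x)"
    if "x \<in> carrier (coord_ring V)" for a b x
    using that by (auto simp: carrier_coord_ring coord_ring_ops const_mult mult.assoc)
  show "\<one>\<^bsub>type_ring\<^esub> \<odot>\<^bsub>coord_ring V\<^esub> x = x" if "x \<in> carrier (coord_ring V)" for x
    using that by (auto simp: carrier_coord_ring coord_ring_ops)
qed (auto simp: cring_type_ring carrier_coord_ring coord_ring_ops single_add distrib_left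
      distrib_right mult.assoc)

end

theory Submission
  imports Defs
begin

text \<open>The difference of \<open>p\<close> and the class of \<open>F\<close> lies in the linear
  subspace \<open>L\<close> and vanishes at every sample, so poisedness makes it zero in the
  coordinate ring. By \<open>coord_eval_class\<close>, \<open>p\<close> and \<open>F\<close> then
  agree on all of \<open>V\<close>; the SOS form and degree bound are already part of the
  pre-certificate.\<close>

theorem proposition1:
  fixes V :: "(complex ^ 'n::finite) set"
    and p :: "('n, real) mpoly set"
    and d :: nat
    and F :: "('n, real) mpoly"
    and Z :: "(complex ^ 'n) set"
    and L :: "('n, real) mpoly set set"
  assumes "algebraic_variety V"
    and "self_conjugate V"
    and "p \<in> carrier (coord_ring V)"
    and "nonneg_on_real_points V p"
    and "sampling_precertificate V d p (F, Z)"
    and "linear_subspace V L"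
    and "p \<in> L"
    and "coord_class V F \<in> L"
    and "poised V L Z"
  shows "correct_precertificate V d p (F, Z)"
proof -
  from assms(3) obtain P where p: "p = coord_class V P"
    by (auto simp: carrier_coord_ring)
  have cert: "is_SOS F" "total_degree F \<le> 2 * d" "Z \<subseteq> V"
    and samples: "\<forall>z\<in>Z. coord_eval p z = ceval F z"
    using assms(5) by auto
  \<comment> \<open>Subtraction is expressed through the two closure properties of a submodule;
    \<open>m_closed\<close> is closure under addition here, the subgroup being one of the additive
    monoid.\<close>
  have "p \<oplus>\<^bsub>coord_ring V\<^esub> ((-1) \<odot>\<^bsub>coord_ring V\<^esub> coord_class V F) \<in> L"
    using submodule.smult_closed[OF assms(6) _ assms(8)]
      subgroup.m_closed[OF submodule.axioms(1)[OF assms(6)] assms(7)] by simp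
  moreover have "Poly_Mapping.single 0 (-1) * F = - F"
    using single_uminus[of "0 :: 'n \<Rightarrow>\<^sub>0 nat" "1::real"] by simp
  ultimately have diff_in_L: "coord_class V (P - F) \<in> L"
    by (simp add: p coord_ring_ops)
  \<comment> \<open>\<open>Z \<subseteq> V\<close> is what lets each class be evaluated through a
    representative.\<close>
  have "\<forall>z\<in>Z. coord_eval (coord_class V (P - F)) z = 0"
    using samples cert(3) by (auto simp: p coord_eval_class ceval_diff subset_iff)
  with assms(9) diff_in_L have "coord_class V (P - F) = coord_class V 0"
    by (auto simp: poised_def coord_ring_ops)
  \<comment> \<open>Evaluating both equal classes at a point of \<open>V\<close> gives
    \<open>P - F\<close> the value 0 there.\<close>
  then have "\<forall>z\<in>V. coord_eval p z = ceval F z"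
    by (metis p coord_eval_class ceval_diff ceval_zero eq_iff_diff_eq_0)
  with cert show ?thesis
    by (simp add: SOS_certificate_def)
qed

end
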